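(* Let $S_1,\ldots,S_N$ be strategies with payoffs $s_{j,t}\in[-1,1]$, $1\le j\le N$, $1\le t\le T$, and let $\mathcal T$ be a binary tree whose leaves are $S_1,\ldots,S_N$ (one leaf each). For each $j$ let $d_j^l$ (resp. $d_j^r$) be the number of left (resp. right) transitions on the path from the root of $\mathcal T$ to $S_j$. There is an absolute constant $c>0$ such that for any $\epsilon>4/\sqrt T$ there exists an online algorithm which at each time $t$ plays a convex combination $p_t=(p_{1,t},\ldots,p_{N,t})$ of $S_1,\ldots,S_N$ (depending only on payoffs up to time $t-1$) and satisfies, for every payoff sequence and every $j=1,\ldots,N$, $$\overline{\text{gain}}\ \ge\ \overline{\text{gain}}(S_j)-d_j^r\,\epsilon-(d_j^r+d_j^l)\,\frac{e^{-c\epsilon^2T}}{\sqrt T},$$ where $\overline{\text{gain}}=\frac1T\sum_{t=1}^T\sum_{i=1}^N p_{i,t}s_{i,t}$ and $\overline{\text{gain}}(S_j)=\frac1T\sum_{t=1}^T s_{j,t}$.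
   Context: Experts problem with full information: $N$ strategies (experts) have adversarial payoffs $s_{j,t}\in[-1,1]$; at each time $t$ the algorithm chooses weights $p_t$ in the probability simplex before the payoffs $s_{\cdot,t}$ are revealed, and receives $\sum_i p_{i,t}s_{i,t}$. *)

theory Defs
  imports Complex_Main
begin

text \<open>
  Binary trees carry labels at their leaves only. Inner nodes with a single child are allowed;
  the left/right position of an only child matters, since it is counted as a transition.
\<close>

datatype 'a bin_tree =
    Leaf 'a
  | Left_Only "'a bin_tree"
  | Right_Only "'a bin_tree"
  | Node "'a bin_tree" "'a bin_tree"

primrec leaves :: "'a bin_tree \<Rightarrow> 'a list" where
  "leaves (Leaf a) = [a]"
| "leaves (Left_Only l) = leaves l"
| "leaves (Right_Only r) = leaves r"
| "leaves (Node l r) = leaves l @ leaves r"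

datatype direction = To_Left | To_Right

text \<open>Meaningful only when \<open>a\<close> labels exactly one leaf.\<close>

primrec path_to :: "'a bin_tree \<Rightarrow> 'a \<Rightarrow> direction list" where
  "path_to (Leaf b) a = []"
| "path_to (Left_Only l) a = To_Left # path_to l a"
| "path_to (Right_Only r) a = To_Right # path_to r a"
| "path_to (Node l r) a =
     (if a \<in> set (leaves l) then To_Left # path_to l a else To_Right # path_to r a)"

definition left_transitions :: "'a bin_tree \<Rightarrow> 'a \<Rightarrow> nat" where
  "left_transitions \<T> a = count_list (path_to \<T> a) To_Left"

definition right_transitions :: "'a bin_tree \<Rightarrow> 'a \<Rightarrow> nat" where
  "right_transitions \<T> a = count_list (path_to \<T> a) To_Right"

definition strategy_tree :: "nat \<Rightarrow> nat bin_tree \<Rightarrow> bool" where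
  "strategy_tree N \<T> \<longleftrightarrow> distinct (leaves \<T>) \<and> set (leaves \<T>) = {1..N}"

text \<open>
  In \<open>s j t\<close> the first argument is the strategy and the second the time. Values outside
  \<open>{1..N}\<close> and \<open>{1..T}\<close> are arbitrary.
\<close>

definition valid_payoffs :: "nat \<Rightarrow> nat \<Rightarrow> (nat \<Rightarrow> nat \<Rightarrow> real) \<Rightarrow> bool" where
  "valid_payoffs N T s \<longleftrightarrow> (\<forall>j\<in>{1..N}. \<forall>t\<in>{1..T}. s j t \<in> {-1..1})"

text \<open>
  An algorithm \<open>p\<close> maps a payoff sequence \<open>s\<close> to the weights \<open>p s i t\<close>. The second conjunct
  says that it is online: the weights at time \<open>t\<close> are determined by the payoffs of the \<open>N\<close>
  strategies at times \<open>1, \<dots>, t - 1\<close>.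
\<close>

definition online_algorithm ::
    "nat \<Rightarrow> nat \<Rightarrow> ((nat \<Rightarrow> nat \<Rightarrow> real) \<Rightarrow> nat \<Rightarrow> nat \<Rightarrow> real) \<Rightarrow> bool" where
  "online_algorithm N T p \<longleftrightarrow>
     (\<forall>s. valid_payoffs N T s \<longrightarrow>
        (\<forall>t\<in>{1..T}. (\<forall>i\<in>{1..N}. p s i t \<ge> 0) \<and> (\<Sum>i=1..N. p s i t) = 1)) \<and>
     (\<forall>s s'. valid_payoffs N T s \<longrightarrow> valid_payoffs N T s' \<longrightarrow>
        (\<forall>t\<in>{1..T}. (\<forall>j\<in>{1..N}. \<forall>u\<in>{1..<t}. s j u = s' j u) \<longrightarrow>
           (\<forall>i\<in>{1..N}. p s i t = p s' i t)))"

definition strategy_gain :: "nat \<Rightarrow> (nat \<Rightarrow> nat \<Rightarrow> real) \<Rightarrow> nat \<Rightarrow> real" where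
  "strategy_gain T s j = 1 / real T * (\<Sum>t=1..T. s j t)"

definition algorithm_gain ::
    "nat \<Rightarrow> nat \<Rightarrow> ((nat \<Rightarrow> nat \<Rightarrow> real) \<Rightarrow> nat \<Rightarrow> nat \<Rightarrow> real) \<Rightarrow> (nat \<Rightarrow> nat \<Rightarrow> real) \<Rightarrow> real" where
  "algorithm_gain N T p s = 1 / real T * (\<Sum>t=1..T. \<Sum>i=1..N. p s i t * s i t)"

end

theory Submission
  imports Defs
begin

text \<open>
  Two strategies with payoffs \<open>l\<close> and \<open>r\<close> are combined by hedging a call option. If a random
  walk \<open>X\<close> with steps \<open>\<plusminus>1\<close> starts at \<open>0\<close>, the option with strike \<open>K = \<epsilon> T / 2\<close> and maturity \<open>T\<close>
  costs \<open>E (X\<^sub>T - K)\<^sup>+\<close>, which by a Chernoff bound is at most of order \<open>\<surd>T exp (- \<epsilon>\<^sup>2 T / 8)\<close>.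
  The hedge ratio at time \<open>t\<close> lies in \<open>[0,1]\<close> and serves as the weight of \<open>r\<close>; by convexity the
  hedge also dominates the option when the step \<open>(r t - l t) / 2\<close> is an arbitrary point of
  \<open>[-1,1]\<close>. Hence the gain over \<open>l\<close> is at least the option's final value minus its price, which
  bounds the loss against \<open>l\<close> by the price and that against \<open>r\<close> by the price plus the strike.
  Every inner node of the tree combines its two children in this way, and the losses
  add up along the path to a leaf.
\<close>

section \<open>Price of a call option on a simple random walk\<close>

text \<open>The first argument is the time to maturity, the second the position relative to the strike.\<close>

primrec call_price :: "nat \<Rightarrow> real \<Rightarrow> real" where
  "call_price 0 y = max 0 y"
| "call_price (Suc n) y = (call_price n (y + 1) + call_price n (y - 1)) / 2"

text \<open>The option's delta, the slope of the chord over \<open>y - 1\<close> and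
  \<open>y + 1\<close>. Here \<open>n\<close> is the time left after the coming step, not before
  it.\<close>

definition hedge_ratio :: "nat \<Rightarrow> real \<Rightarrow> real" where
  "hedge_ratio n y = (call_price n (y + 1) - call_price n (y - 1)) / 2"

lemma call_price_mono: "y \<le> z \<Longrightarrow> call_price n y \<le> call_price n z"
proof (induction n arbitrary: y z)
  case (Suc n)
  from Suc.IH[of "y + 1" "z + 1"] Suc.IH[of "y - 1" "z - 1"] Suc.prems show ?case
    by simp
qed simp

lemma call_price_lipschitz: "y \<le> z \<Longrightarrow> call_price n z - call_price n y \<le> z - y"
proof (induction n arbitrary: y z)
  case (Suc n)
  from Suc.IH[of "y + 1" "z + 1"] Suc.IH[of "y - 1" "z - 1"] Suc.prems show ?case
    by (simp add: field_simps)
qed simp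

lemma hedge_ratio_bounds: "0 \<le> hedge_ratio n y" "hedge_ratio n y \<le> 1"
  using call_price_mono[of "y - 1" "y + 1" n] call_price_lipschitz[of "y - 1" "y + 1" n]
  by (simp_all add: hedge_ratio_def)

text \<open>Jensen's inequality at \<open>y + x\<close>, a convex combination of
  \<open>y + 1\<close> and \<open>y - 1\<close>. It holds for \<open>max 0\<close>, and averaging
  two shifted copies preserves it.\<close>

lemma call_price_convex_step:
  assumes "-1 \<le> x" "x \<le> 1"
  shows "call_price n (y + x) \<le> (1 + x) / 2 * call_price n (y + 1) + (1 - x) / 2 * call_price n (y - 1)"
proof (induction n arbitrary: y)
  case 0
  have "0 \<le> (1 + x) / 2 * max 0 (y + 1) + (1 - x) / 2 * max 0 (y - 1)"
    using assms by (intro add_nonneg_nonneg mult_nonneg_nonneg) auto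
  moreover have "(1 + x) / 2 * (y + 1) + (1 - x) / 2 * (y - 1)
      \<le> (1 + x) / 2 * max 0 (y + 1) + (1 - x) / 2 * max 0 (y - 1)"
    using assms by (intro add_mono mult_left_mono) auto
  moreover have "(1 + x) / 2 * (y + 1) + (1 - x) / 2 * (y - 1) = y + x"
    by (simp add: field_simps)
  ultimately show ?case
    by simp
next
  case (Suc n)
  from Suc.IH[of "y + 1"] Suc.IH[of "y - 1"] show ?case
    by (simp add: field_simps)
qed

text \<open>The chord over \<open>y - 1\<close> and \<open>y + 1\<close> has height
  \<open>call_price (Suc n) y\<close> at \<open>y\<close> and slope \<open>hedge_ratio n y\<close>;
  by convexity the price lies below it.\<close>

lemma call_price_hedge_step:
  assumes "-1 \<le> x" "x \<le> 1"
  shows "call_price n (y + x) \<le> call_price (Suc n) y + hedge_ratio n y * x"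
  using call_price_convex_step[OF assms, of n y] by (simp add: hedge_ratio_def field_simps)

section \<open>Exponential bound on the price\<close>

lemma tanh_le_self: "0 \<le> x \<Longrightarrow> tanh x \<le> (x::real)"
proof -
  assume "0 \<le> x"
  have "(\<lambda>x. x - tanh x) 0 \<le> (\<lambda>x. x - tanh x) x"
  proof (rule DERIV_nonneg_imp_nondecreasing[OF \<open>0 \<le> x\<close>])
    fix u :: real
    have "((\<lambda>x. x - tanh x) has_real_derivative (tanh u)\<^sup>2) (at u)"
      by (auto intro!: derivative_eq_intros)
    then show "\<exists>d. ((\<lambda>x. x - tanh x) has_real_derivative d) (at u) \<and> 0 \<le> d"
      by (metis zero_le_power2)
  qed
  then show ?thesis by simp
qed

text \<open>Subgaussian bound for the moment generating function of a fair sign: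
  \<open>x\<^sup>2 / 2 - ln (cosh x)\<close> vanishes at 0 and has derivative
  \<open>x - tanh x\<close>.\<close>

lemma cosh_le_exp_half_square:
  assumes "0 \<le> (x::real)"
  shows "cosh x \<le> exp (x\<^sup>2 / 2)"
proof -
  have "(\<lambda>x. x\<^sup>2 / 2 - ln (cosh x)) 0 \<le> (\<lambda>x. x\<^sup>2 / 2 - ln (cosh x)) x"
  proof (rule DERIV_nonneg_imp_nondecreasing[OF assms])
    fix u :: real
    assume "0 \<le> u"
    have "((\<lambda>x. x\<^sup>2 / 2 - ln (cosh x)) has_real_derivative (u - tanh u)) (at u)"
      by (auto intro!: derivative_eq_intros simp: tanh_def divide_simps)
    then show "\<exists>d. ((\<lambda>x. x\<^sup>2 / 2 - ln (cosh x)) has_real_derivative d) (at u) \<and> 0 \<le> d"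
      using tanh_le_self[OF \<open>0 \<le> u\<close>] by (intro exI[of _ "u - tanh u"]) simp
  qed
  then have "ln (cosh x) \<le> x\<^sup>2 / 2"
    by simp
  then have "exp (ln (cosh x)) \<le> exp (x\<^sup>2 / 2)"
    by (simp only: exp_le_cancel_iff)
  then show ?thesis
    using cosh_real_pos[of x] by (simp only: exp_ln)
qed

text \<open>At maturity \<open>max 0 y\<close> is at most \<open>exp (L * y) / L\<close>, and each
  averaging step multiplies this exponential by \<open>cosh L\<close>.\<close>

lemma call_price_le_exp:
  assumes "L > 0"
  shows "call_price n y \<le> exp (real n * (L\<^sup>2 / 2) + L * y) / L"
proof (induction n arbitrary: y)
  case 0
  have "L * max 0 y \<le> exp (L * y)"
    using exp_ge_add_one_self[of "L * y"] by (simp add: max_def del: exp_ge_add_one_self)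
  then have "max 0 y \<le> exp (L * y) / L"
    using assms by (simp only: pos_le_divide_eq mult.commute)
  then show ?case by simp
next
  case (Suc n)
  define A where "A = exp (real n * (L\<^sup>2 / 2) + L * y) / L"
  have up: "exp (real n * (L\<^sup>2 / 2) + L * (y + 1)) / L = A * exp L"
    and down: "exp (real n * (L\<^sup>2 / 2) + L * (y - 1)) / L = A * exp (- L)"
    by (simp_all add: A_def exp_add[symmetric] algebra_simps)
  have "call_price (Suc n) y \<le> (A * exp L + A * exp (- L)) / 2"
    using Suc.IH[of "y + 1"] Suc.IH[of "y - 1"] up down by simp
  also have "\<dots> = A * cosh L"
    by (simp add: cosh_def algebra_simps)
  also have "\<dots> \<le> A * exp (L\<^sup>2 / 2)"
    using assms cosh_le_exp_half_square[of L] by (intro mult_left_mono) (auto simp: A_def)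
  also have "\<dots> = exp (real (Suc n) * (L\<^sup>2 / 2) + L * y) / L"
    by (simp add: A_def exp_add[symmetric] algebra_simps)
  finally show ?case .
qed

lemma call_price_at_strike:
  assumes "\<epsilon> > 4 / sqrt (real T)" "T \<ge> 1"
  shows "2 * call_price T (- (\<epsilon> * real T / 2))
    \<le> real T * (exp (- (1/8) * \<epsilon>\<^sup>2 * real T) / sqrt (real T))"
proof -
  have sq: "sqrt (real T) > 0"
    using assms(2) by simp
  then have pos: "\<epsilon> > 0"
    using assms(1) by (meson divide_pos_pos less_trans zero_less_numeral)
  \<comment> \<open>The choice \<open>L = \<epsilon> / 2\<close> minimises the exponent
    \<open>T * L\<^sup>2 / 2 - L * \<epsilon> * T / 2\<close>; its minimum is the source of the
    constant 1/8.\<close>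
  have "real T * ((\<epsilon> / 2)\<^sup>2 / 2) + \<epsilon> / 2 * (- (\<epsilon> * real T / 2)) = - (1/8) * \<epsilon>\<^sup>2 * real T"
    by (simp add: power2_eq_square field_simps)
  with call_price_le_exp[of "\<epsilon> / 2" T "- (\<epsilon> * real T / 2)"] pos
  have "call_price T (- (\<epsilon> * real T / 2)) \<le> exp (- (1/8) * \<epsilon>\<^sup>2 * real T) / (\<epsilon> / 2)"
    by simp
  then have "2 * call_price T (- (\<epsilon> * real T / 2)) \<le> 4 / \<epsilon> * exp (- (1/8) * \<epsilon>\<^sup>2 * real T)"
    by simp
  \<comment> \<open>The lower bound on \<open>\<epsilon>\<close> in the form
    \<open>4 / \<epsilon> \<le> sqrt (real T)\<close>.\<close>
  also have "\<dots> \<le> sqrt (real T) * exp (- (1/8) * \<epsilon>\<^sup>2 * real T)"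
    using assms(1) sq pos by (intro mult_right_mono) (auto simp: field_simps)
  also have "\<dots> = real T * (exp (- (1/8) * \<epsilon>\<^sup>2 * real T) / sqrt (real T))"
    using sq by (simp add: field_simps flip: power2_eq_square)
  finally show ?thesis .
qed

section \<open>Combining two strategies\<close>

text \<open>Halving the difference brings the walk's steps into [-1,1]. The position stops at time
  \<open>t - 1\<close>, so the weight is fixed before the payoffs at \<open>t\<close> are
  seen.\<close>

definition right_weight :: "nat \<Rightarrow> real \<Rightarrow> (nat \<Rightarrow> real) \<Rightarrow> (nat \<Rightarrow> real) \<Rightarrow> nat \<Rightarrow> real" where
  "right_weight T \<epsilon> l r t =
     hedge_ratio (T - t) ((\<Sum>u=1..<t. (r u - l u) / 2) - \<epsilon> * real T / 2)"

definition mix :: "nat \<Rightarrow> real \<Rightarrow> (nat \<Rightarrow> real) \<Rightarrow> (nat \<Rightarrow> real) \<Rightarrow> nat \<Rightarrow> real" where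
  "mix T \<epsilon> l r t = (1 - right_weight T \<epsilon> l r t) * l t + right_weight T \<epsilon> l r t * r t"

lemma right_weight_bounds: "0 \<le> right_weight T \<epsilon> l r t" "right_weight T \<epsilon> l r t \<le> 1"
  by (simp_all add: right_weight_def hedge_ratio_bounds)

lemma right_weight_cong:
  assumes "\<And>u. 1 \<le> u \<Longrightarrow> u < t \<Longrightarrow> l u = l' u" "\<And>u. 1 \<le> u \<Longrightarrow> u < t \<Longrightarrow> r u = r' u"
  shows "right_weight T \<epsilon> l r t = right_weight T \<epsilon> l' r' t"
proof -
  have "(\<Sum>u=1..<t. (r u - l u) / 2) = (\<Sum>u=1..<t. (r' u - l' u) / 2)"
    using assms by (intro sum.cong) auto
  then show ?thesis by (simp add: right_weight_def)
qed

lemma convex_combination_bounds: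
  fixes a b :: real
  assumes "a \<in> {-1..1}" "b \<in> {-1..1}" "0 \<le> w" "w \<le> 1"
  shows "(1 - w) * a + w * b \<in> {-1..1}"
proof -
  have "(1 - w) * a + w * b \<le> (1 - w) * 1 + w * 1"
    using assms by (intro add_mono mult_left_mono) auto
  moreover have "(1 - w) * (-1) + w * (-1) \<le> (1 - w) * a + w * b"
    using assms by (intro add_mono mult_left_mono) auto
  ultimately show ?thesis by simp
qed

lemma mix_bounds:
  "l t \<in> {-1..1} \<Longrightarrow> r t \<in> {-1..1} \<Longrightarrow> mix T \<epsilon> l r t \<in> {-1..1}"
  unfolding mix_def by (rule convex_combination_bounds) (auto simp: right_weight_bounds)

text \<open>Starting from the option's initial price, the accumulated hedging gains keep the
  portfolio above the option's current value; each time step is one use of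
  \<open>call_price_hedge_step\<close>.\<close>

lemma call_price_replication:
  assumes "n \<le> T" "\<forall>t\<in>{1..T}. l t \<in> {-1..1}" "\<forall>t\<in>{1..T}. r t \<in> {-1..1}"
  shows "call_price (T - n) ((\<Sum>t=1..n. (r t - l t) / 2) - \<epsilon> * real T / 2)
    \<le> call_price T (- (\<epsilon> * real T / 2)) + (\<Sum>t=1..n. right_weight T \<epsilon> l r t * ((r t - l t) / 2))"
  using assms(1)
proof (induction n)
  case (Suc n)
  define y where "y = (\<Sum>t=1..n. (r t - l t) / 2) - \<epsilon> * real T / 2"
  define x where "x = (r (Suc n) - l (Suc n)) / 2"
  have "l (Suc n) \<in> {-1..1}" "r (Suc n) \<in> {-1..1}"
    using assms(2,3) Suc.prems by auto
  then have "-1 \<le> x" "x \<le> 1"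
    by (auto simp: x_def)
  then have "call_price (T - Suc n) (y + x)
      \<le> call_price (Suc (T - Suc n)) y + hedge_ratio (T - Suc n) y * x"
    by (rule call_price_hedge_step)
  \<comment> \<open>Subtraction on naturals is truncated, so this relies on
    \<open>Suc n \<le> T\<close>.\<close>
  moreover have "Suc (T - Suc n) = T - n"
    using Suc.prems by simp
  moreover have "hedge_ratio (T - Suc n) y = right_weight T \<epsilon> l r (Suc n)"
    by (simp add: right_weight_def y_def atLeastLessThanSuc_atLeastAtMost)
  ultimately have step: "call_price (T - Suc n) (y + x)
      \<le> call_price (T - n) y + right_weight T \<epsilon> l r (Suc n) * x"
    by (simp only:)
  have position: "(\<Sum>t=1..Suc n. (r t - l t) / 2) - \<epsilon> * real T / 2 = y + x"
    by (simp add: y_def x_def)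
  have gain: "(\<Sum>t=1..Suc n. right_weight T \<epsilon> l r t * ((r t - l t) / 2))
      = (\<Sum>t=1..n. right_weight T \<epsilon> l r t * ((r t - l t) / 2)) + right_weight T \<epsilon> l r (Suc n) * x"
    by (simp add: x_def)
  have "call_price (T - n) y
      \<le> call_price T (- (\<epsilon> * real T / 2)) + (\<Sum>t=1..n. right_weight T \<epsilon> l r t * ((r t - l t) / 2))"
    using Suc.IH Suc.prems by (simp add: y_def)
  with step show ?case
    unfolding position gain by linarith
qed simp

text \<open>The mixture gains the total of \<open>l\<close> plus twice the hedging gain. Bounding
  the option's final value below by each argument of \<open>max\<close> gives the two
  claims.\<close>

lemma mix_gain:
  assumes "\<epsilon> > 4 / sqrt (real T)" "T \<ge> 1"
    and "\<forall>t\<in>{1..T}. l t \<in> {-1..1}" "\<forall>t\<in>{1..T}. r t \<in> {-1..1}"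
  defines "\<delta> \<equiv> real T * (exp (- (1/8) * \<epsilon>\<^sup>2 * real T) / sqrt (real T))"
  shows "(\<Sum>t=1..T. mix T \<epsilon> l r t) \<ge> (\<Sum>t=1..T. l t) - \<delta>"
    and "(\<Sum>t=1..T. mix T \<epsilon> l r t) \<ge> (\<Sum>t=1..T. r t) - \<epsilon> * real T - \<delta>"
proof -
  define H where "H = (\<Sum>t=1..T. right_weight T \<epsilon> l r t * ((r t - l t) / 2))"
  have "(\<Sum>t=1..T. mix T \<epsilon> l r t) = (\<Sum>t=1..T. l t) + 2 * H"
    unfolding H_def mix_def sum_distrib_left sum.distrib[symmetric]
    by (intro sum.cong) (auto simp: field_simps)
  moreover have "(\<Sum>t=1..T. (r t - l t) / 2) = ((\<Sum>t=1..T. r t) - (\<Sum>t=1..T. l t)) / 2"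
    by (simp add: sum_subtractf sum_divide_distrib[symmetric])
  \<comment> \<open>At \<open>n = T\<close> no time is left, so the price is the option's final
    value.\<close>
  then have "max 0 (((\<Sum>t=1..T. r t) - (\<Sum>t=1..T. l t)) / 2 - \<epsilon> * real T / 2)
      \<le> call_price T (- (\<epsilon> * real T / 2)) + H"
    using call_price_replication[OF order_refl assms(3,4), of \<epsilon>]
    by (simp only: H_def diff_self_eq_0 call_price.simps)
  moreover have "2 * call_price T (- (\<epsilon> * real T / 2)) \<le> \<delta>"
    unfolding \<delta>_def by (rule call_price_at_strike[OF assms(1,2)])
  ultimately show "(\<Sum>t=1..T. mix T \<epsilon> l r t) \<ge> (\<Sum>t=1..T. l t) - \<delta>"
    and "(\<Sum>t=1..T. mix T \<epsilon> l r t) \<ge> (\<Sum>t=1..T. r t) - \<epsilon> * real T - \<delta>"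
    by (simp_all add: field_simps)
qed

section \<open>Combining along a tree\<close>

context
  fixes T :: nat and \<epsilon> :: real and s :: "'a \<Rightarrow> nat \<Rightarrow> real"
begin

primrec tree_payoff :: "'a bin_tree \<Rightarrow> nat \<Rightarrow> real" where
  "tree_payoff (Leaf a) = s a"
| "tree_payoff (Left_Only l) = tree_payoff l"
| "tree_payoff (Right_Only r) = tree_payoff r"
| "tree_payoff (Node l r) = mix T \<epsilon> (tree_payoff l) (tree_payoff r)"

text \<open>The nested mixtures flattened into one weight vector on the leaf labels.\<close>

primrec tree_weight :: "'a bin_tree \<Rightarrow> 'a \<Rightarrow> nat \<Rightarrow> real" where
  "tree_weight (Leaf a) i t = (if i = a then 1 else 0)"
| "tree_weight (Left_Only l) i t = tree_weight l i t"
| "tree_weight (Right_Only r) i t = tree_weight r i t"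
| "tree_weight (Node l r) i t =
     (1 - right_weight T \<epsilon> (tree_payoff l) (tree_payoff r) t) * tree_weight l i t
     + right_weight T \<epsilon> (tree_payoff l) (tree_payoff r) t * tree_weight r i t"

lemma tree_payoff_bounds:
  "\<forall>a\<in>set (leaves \<T>). s a t \<in> {-1..1} \<Longrightarrow> tree_payoff \<T> t \<in> {-1..1}"
proof (induction \<T>)
  case (Node l r)
  then have "tree_payoff l t \<in> {-1..1}" "tree_payoff r t \<in> {-1..1}"
    by auto
  then show ?case
    unfolding tree_payoff.simps by (rule mix_bounds)
qed auto

lemma tree_weight_nonneg: "0 \<le> tree_weight \<T> i t"
  by (induction \<T>) (auto simp: right_weight_bounds)

text \<open>Any finite superset \<open>A\<close> of the labels is allowed, so that both subtrees can
  be summed over the same set; labels outside a subtree get weight 0 there.\<close>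

lemma sum_tree_weight:
  "finite A \<Longrightarrow> set (leaves \<T>) \<subseteq> A \<Longrightarrow> (\<Sum>i\<in>A. tree_weight \<T> i t) = 1"
  by (induction \<T>) (auto simp: sum.distrib sum_distrib_left[symmetric])

lemma sum_tree_weight_payoff:
  "finite A \<Longrightarrow> set (leaves \<T>) \<subseteq> A \<Longrightarrow> (\<Sum>i\<in>A. tree_weight \<T> i t * s i t) = tree_payoff \<T> t"
proof (induction \<T>)
  case (Leaf a)
  have "(\<Sum>i\<in>A. tree_weight (Leaf a) i t * s i t) = (\<Sum>i\<in>A. if i = a then s i t else 0)"
    by (intro sum.cong) auto
  with Leaf show ?case by simp
next
  case (Node l r)
  then show ?case
    by (simp add: mix_def distrib_right sum.distrib mult.assoc sum_distrib_left[symmetric])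
qed auto

text \<open>By \<open>mix_gain\<close>, a step down from a \<open>Node\<close> costs
  \<open>\<delta>\<close> to the left and \<open>\<epsilon> * real T + \<delta>\<close> to the
  right.\<close>

lemma tree_payoff_gain:
  assumes "\<epsilon> > 4 / sqrt (real T)" "T \<ge> 1" "a \<in> set (leaves \<T>)"
    and "\<forall>a\<in>set (leaves \<T>). \<forall>t\<in>{1..T}. s a t \<in> {-1..1}"
  defines "\<delta> \<equiv> real T * (exp (- (1/8) * \<epsilon>\<^sup>2 * real T) / sqrt (real T))"
  shows "(\<Sum>t=1..T. tree_payoff \<T> t) \<ge> (\<Sum>t=1..T. s a t)
    - real (right_transitions \<T> a) * (\<epsilon> * real T)
    - real (right_transitions \<T> a + left_transitions \<T> a) * \<delta>"
  using assms(3,4)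
proof (induction \<T>)
  case (Leaf b)
  then show ?case by (simp add: right_transitions_def left_transitions_def)
next
  case (Left_Only l)
  \<comment> \<open>An only child passes its payoff up without loss, while its transition still
    counts; a nonnegative charge only weakens the bound.\<close>
  moreover have "\<delta> \<ge> 0" by (simp add: \<delta>_def)
  ultimately show ?case
    by (simp add: right_transitions_def left_transitions_def algebra_simps)
next
  case (Right_Only r)
  have "0 < \<epsilon>"
    using assms(1) by (rule le_less_trans[rotated]) simp
  then have "\<delta> \<ge> 0" "\<epsilon> * real T \<ge> 0" by (simp_all add: \<delta>_def)
  with Right_Only show ?case
    by (simp add: right_transitions_def left_transitions_def algebra_simps)
next
  case (Node l r)
  have "\<forall>t\<in>{1..T}. tree_payoff l t \<in> {-1..1}" "\<forall>t\<in>{1..T}. tree_payoff r t \<in> {-1..1}"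
    using Node.prems(2) by (auto intro!: tree_payoff_bounds simp del: atLeastAtMost_iff)
  note gain = mix_gain[OF assms(1,2) this, folded \<delta>_def]
  show ?case
  proof (cases "a \<in> set (leaves l)")
    case True
    then show ?thesis
      using gain(1) Node
      by (simp add: right_transitions_def left_transitions_def algebra_simps)
  next
    case False
    then show ?thesis
      using gain(2) Node
      by (simp add: right_transitions_def left_transitions_def algebra_simps)
  qed
qed

end

section \<open>Dependence on past payoffs\<close>

lemma tree_payoff_cong:
  assumes "\<forall>a\<in>set (leaves \<T>). \<forall>u\<in>{1..t}. s a u = s' a u" "1 \<le> t"
  shows "tree_payoff T \<epsilon> s \<T> t = tree_payoff T \<epsilon> s' \<T> t"
  \<comment> \<open>The weight at \<open>t\<close> involves subtree payoffs at all earlier times,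
    hence the generalisation over \<open>t\<close>.\<close>
  using assms
proof (induction \<T> arbitrary: t)
  case (Node l r)
  then have eq: "tree_payoff T \<epsilon> s l u = tree_payoff T \<epsilon> s' l u"
      "tree_payoff T \<epsilon> s r u = tree_payoff T \<epsilon> s' r u" if "1 \<le> u" "u \<le> t" for u
    using that by simp_all
  then have "right_weight T \<epsilon> (tree_payoff T \<epsilon> s l) (tree_payoff T \<epsilon> s r) t
      = right_weight T \<epsilon> (tree_payoff T \<epsilon> s' l) (tree_payoff T \<epsilon> s' r) t"
    by (intro right_weight_cong) auto
  with eq[of t] Node.prems(2) show ?case
    by (simp add: mix_def)
qed auto

text \<open>Unlike the payoff at \<open>t\<close>, the weight consults subtree payoffs only strictly
  before \<open>t\<close>, which is what makes the algorithm online.\<close>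

lemma tree_weight_cong:
  assumes "\<forall>a\<in>set (leaves \<T>). \<forall>u\<in>{1..<t}. s a u = s' a u"
  shows "tree_weight T \<epsilon> s \<T> i t = tree_weight T \<epsilon> s' \<T> i t"
  using assms
proof (induction \<T>)
  case (Node l r)
  then have "right_weight T \<epsilon> (tree_payoff T \<epsilon> s l) (tree_payoff T \<epsilon> s r) t
      = right_weight T \<epsilon> (tree_payoff T \<epsilon> s' l) (tree_payoff T \<epsilon> s' r) t"
    by (intro right_weight_cong tree_payoff_cong) auto
  with Node show ?case by simp
qed auto

theorem theorem3:
  "\<exists>c::real. c > 0 \<and>
    (\<forall>(N::nat) (T::nat) (\<T>::nat bin_tree) (\<epsilon>::real).
       N \<ge> 1 \<longrightarrow> T \<ge> 1 \<longrightarrow> strategy_tree N \<T> \<longrightarrow> \<epsilon> > 4 / sqrt (real T) \<longrightarrow>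
       (\<exists>p. online_algorithm N T p \<and>
         (\<forall>s. valid_payoffs N T s \<longrightarrow>
           (\<forall>j\<in>{1..N}.
              algorithm_gain N T p s \<ge>
                strategy_gain T s j
                - real (right_transitions \<T> j) * \<epsilon>
                - real (right_transitions \<T> j + left_transitions \<T> j)
                    * (exp (- c * \<epsilon>\<^sup>2 * real T) / sqrt (real T))))))"
proof (intro exI[of _ "1/8 :: real"] conjI allI impI)
  fix N T :: nat and \<T> :: "nat bin_tree" and \<epsilon> :: real
  assume "N \<ge> 1" and T: "T \<ge> 1" and tree: "strategy_tree N \<T>" and eps: "\<epsilon> > 4 / sqrt (real T)"
  from tree have leaves: "set (leaves \<T>) = {1..N}"
    by (simp add: strategy_tree_def)
  define p where "p s = tree_weight T \<epsilon> s \<T>" for s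
  show "\<exists>p. online_algorithm N T p \<and>
         (\<forall>s. valid_payoffs N T s \<longrightarrow>
           (\<forall>j\<in>{1..N}.
              algorithm_gain N T p s \<ge>
                strategy_gain T s j
                - real (right_transitions \<T> j) * \<epsilon>
                - real (right_transitions \<T> j + left_transitions \<T> j)
                    * (exp (- (1/8) * \<epsilon>\<^sup>2 * real T) / sqrt (real T))))"
  proof (intro exI[of _ p] conjI allI impI ballI)
    show "online_algorithm N T p"
      unfolding online_algorithm_def p_def
      using leaves
      by (auto intro!: tree_weight_nonneg sum_tree_weight tree_weight_cong)
  next
    fix s j
    assume valid: "valid_payoffs N T s" and j: "j \<in> {1..N}"
    define \<delta> where "\<delta> = exp (- (1/8) * \<epsilon>\<^sup>2 * real T) / sqrt (real T)"
    have "(\<Sum>t=1..T. \<Sum>i=1..N. p s i t * s i t) = (\<Sum>t=1..T. tree_payoff T \<epsilon> s \<T> t)"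
      unfolding p_def using leaves by (intro sum.cong sum_tree_weight_payoff) auto
    moreover have "(\<Sum>t=1..T. tree_payoff T \<epsilon> s \<T> t) \<ge> (\<Sum>t=1..T. s j t)
        - real (right_transitions \<T> j) * (\<epsilon> * real T)
        - real (right_transitions \<T> j + left_transitions \<T> j) * (real T * \<delta>)"
      unfolding \<delta>_def using valid j leaves
      by (intro tree_payoff_gain[OF eps T]) (auto simp: valid_payoffs_def)
    \<comment> \<open>Every loss term carries the factor \<open>real T\<close>; pulling it out
      prepares the passage from totals to averages.\<close>
    moreover have "(\<Sum>t=1..T. s j t)
        - real (right_transitions \<T> j) * (\<epsilon> * real T)
        - real (right_transitions \<T> j + left_transitions \<T> j) * (real T * \<delta>)
        = (\<Sum>t=1..T. s j t) - real T * (real (right_transitions \<T> j) * \<epsilon>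
        + real (right_transitions \<T> j + left_transitions \<T> j) * \<delta>)"
      by (simp add: algebra_simps)
    ultimately have "((\<Sum>t=1..T. s j t) - real T * (real (right_transitions \<T> j) * \<epsilon>
        + real (right_transitions \<T> j + left_transitions \<T> j) * \<delta>)) / real T
        \<le> (\<Sum>t=1..T. \<Sum>i=1..N. p s i t * s i t) / real T"
      by (intro divide_right_mono) auto
    then have "algorithm_gain N T p s \<ge> strategy_gain T s j
        - real (right_transitions \<T> j) * \<epsilon>
        - real (right_transitions \<T> j + left_transitions \<T> j) * \<delta>"
      using T by (simp add: algorithm_gain_def strategy_gain_def diff_divide_distrib)
    then show "algorithm_gain N T p s \<ge> strategy_gain T s j
        - real (right_transitions \<T> j) * \<epsilon>
        - real (right_transitions \<T> j + left_transitions \<T> j)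
            * (exp (- (1/8) * \<epsilon>\<^sup>2 * real T) / sqrt (real T))"
      by (simp only: \<delta>_def)
  qed
qed simp

end
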